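(* Let $\varphi$ be a pseudomultiplier of a Hilbert function space $\mathcal H$ on a set $\Omega$. If $\alpha\in\Omega$ is a pseudopole of $\varphi$ and $\alpha$ is in the closure of $D_\varphi$ in $\Omega$, then $P_{\mathcal A_\varphi^\perp}k_\alpha$ is a polar vector of $\varphi$.
   Context: A Hilbert function space on a set $\Omega$ is a complex Hilbert space $\mathcal H$ whose elements are complex-valued functions on $\Omega$ (with pointwise operations) such that for each $\lambda\in\Omega$ the functional $f\mapsto f(\lambda)$ is continuous; $k_\lambda\in\mathcal H$ denotes the element with $f(\lambda)=\langle f,k_\lambda\rangle$ for all $f\in\mathcal H$. A subset $D\subset\Omega$ is a set of uniqueness for $\mathcal H$ if any $f,g\in\mathcal H$ that agree on $D$ are equal. The closure of a subset of $\Omega$ is taken with respect to the (pseudo)metric $d(\lambda,\mu)=\|k_\lambda-k_\mu\|$ on $\Omega$. A function $\varphi:D_\varphi\subset\Omega\to\mathbb C$ is a pseudomultiplier of $\mathcal H$ if (1) $D_\varphi$ is a set of uniqueness for $\mathcal H$; (2) $E_\varphi=\{h\in\mathcal H:\text{ there exists } g\in\mathcal H \text{ with } g(\lambda)=\varphi(\lambda)h(\lambda)\text{ for all }\lambda\in D_\varphi\}$ is closed in $\mathcal H$; (3) $E_\varphi$ has finite codimension in $\mathcal H$. A point $\alpha\in\Omega$ is a pseudopole of $\varphi$ if there exist $g\in\mathcal H$ and $h\in E_\varphi$ such that $h(\alpha)=0$, $g$ extends $\varphi h$ (i.e. $g=\varphi h$ on $D_\varphi$) and $g(\alpha)\ne0$.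 Seeing a vector: for $v\in\mathcal H$, let $p\notin\Omega$, and for $f\in\mathcal H$ define $f_v:\Omega\cup\{p\}\to\mathbb C$ by $f_v=f$ on $\Omega$ and $f_v(p)=\langle f,v\rangle$. Let $\mathcal H_v=\{f_v:f\in\mathcal H\}$ with $\langle f_v,g_v\rangle_{\mathcal H_v}=\langle f,g\rangle_{\mathcal H}$; this is a Hilbert function space on $\Omega\cup\{p\}$. The pseudomultiplier $\varphi$ of $\mathcal H$ sees $v$ with value $c\in\mathbb C$ if there exists a pseudomultiplier $\psi$ of $\mathcal H_v$ such that $D_\varphi\subseteq D_\psi$, $\psi|D_\varphi=\varphi$, $p\in D_\psi$, $E_\varphi=E_\psi|\Omega:=\{F|\Omega:F\in E_\psi\}$, and $\psi(p)=c$. $\varphi$ sees $v$ if it sees $v$ with some value $c$. Ambiguous vectors: $\mathcal A_\varphi$ is the set of $v\in\mathcal H$ such that $\varphi$ sees $v$ with value $c$ for every $c\in\mathbb C$; it is a finite-dimensional subspace of $\mathcal H$, and $P_{\mathcal A_\varphi^\perp}$ is the orthogonal projection onto its orthogonal complement. Definable vectors: $d\in\mathcal H$ is definable for $\varphi$ if $d\neq0$, $\varphi$ sees $d$, and $d\perp\mathcal A_\varphi$; $\mathbf D_\varphi$ is the set of definable vectors. For $d\in\mathbf D_\varphi$ there is a unique $c\in\mathbb C$ such that $\varphi$ sees $d$ with value $c$; it is denoted $\varphi(d)$. Polar vectors: $q\in\mathcal H$ is a polar vector for $\varphi$ if $q\ne0$ and there is a sequence $(d_n)$ in $\mathbf D_\varphi$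 with $d_n\to q$ in norm and $\varphi(d_n)\to\infty$ (i.e. $|\varphi(d_n)|\to\infty$). *)

theory Defs
  imports "HOL-Analysis.Analysis" "HOL-Library.Function_Algebras"
begin

text \<open>
  The set on which the functions live is a type \<open>'a\<close>, so that functions on it are
  elements of \<open>'a \<Rightarrow> complex\<close>, with the pointwise operations of \<open>Function_Algebras\<close>.
  Inner products are linear in the first argument.
\<close>

definition fscale :: "complex \<Rightarrow> ('a \<Rightarrow> complex) \<Rightarrow> 'a \<Rightarrow> complex" where
  "fscale c f = (\<lambda>x. c * f x)"

interpretation cfun: vector_space "fscale :: complex \<Rightarrow> ('a \<Rightarrow> complex) \<Rightarrow> 'a \<Rightarrow> complex"
  by unfold_locales (auto simp: fscale_def fun_eq_iff algebra_simps)

record 'a fun_space =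
  elems :: "('a \<Rightarrow> complex) set"
  ip :: "('a \<Rightarrow> complex) \<Rightarrow> ('a \<Rightarrow> complex) \<Rightarrow> complex"

definition fnorm :: "'a fun_space \<Rightarrow> ('a \<Rightarrow> complex) \<Rightarrow> real" where
  "fnorm H f = sqrt (Re (ip H f f))"

text \<open>
  \<open>Metric_space\<close> requires a distance that is nonnegative and symmetric on the whole
  type, hence the irrelevant value 0 outside the space.
\<close>

definition fdist :: "'a fun_space \<Rightarrow> ('a \<Rightarrow> complex) \<Rightarrow> ('a \<Rightarrow> complex) \<Rightarrow> real" where
  "fdist H f g = (if f \<in> elems H \<and> g \<in> elems H then fnorm H (f - g) else 0)"

abbreviation ftopology :: "'a fun_space \<Rightarrow> ('a \<Rightarrow> complex) topology" where
  "ftopology H \<equiv> Metric_space.mtopology (elems H) (fdist H)"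

definition hilbert_function_space :: "'a fun_space \<Rightarrow> bool" where
  "hilbert_function_space H \<longleftrightarrow>
     cfun.subspace (elems H) \<and>
     (\<forall>f\<in>elems H. \<forall>g\<in>elems H. \<forall>h\<in>elems H. ip H (f + g) h = ip H f h + ip H g h) \<and>
     (\<forall>c. \<forall>f\<in>elems H. \<forall>g\<in>elems H. ip H (fscale c f) g = c * ip H f g) \<and>
     (\<forall>f\<in>elems H. \<forall>g\<in>elems H. ip H g f = cnj (ip H f g)) \<and>
     (\<forall>f\<in>elems H. f \<noteq> 0 \<longrightarrow> 0 < Re (ip H f f)) \<and>
     Metric_space.mcomplete (elems H) (fdist H) \<and>
     (\<forall>x. continuous_map (ftopology H) euclidean (\<lambda>f. f x))"

definition repr_kernel :: "'a fun_space \<Rightarrow> 'a \<Rightarrow> 'a \<Rightarrow> complex" where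
  "repr_kernel H x = (THE k. k \<in> elems H \<and> (\<forall>f\<in>elems H. f x = ip H f k))"

definition set_of_uniqueness :: "'a fun_space \<Rightarrow> 'a set \<Rightarrow> bool" where
  "set_of_uniqueness H D \<longleftrightarrow>
     (\<forall>f\<in>elems H. \<forall>g\<in>elems H. (\<forall>x\<in>D. f x = g x) \<longrightarrow> f = g)"

text \<open>Closure in the pseudometric \<open>d x y = \<parallel>k\<^sub>x - k\<^sub>y\<parallel>\<close> on the underlying set.\<close>

definition kernel_closure :: "'a fun_space \<Rightarrow> 'a set \<Rightarrow> 'a set" where
  "kernel_closure H D = {x. \<forall>e>0. \<exists>y\<in>D. fdist H (repr_kernel H x) (repr_kernel H y) < e}"

text \<open>A function with domain \<open>D\<close> is a partial map \<open>\<phi>\<close> with \<open>dom \<phi> = D\<close>.\<close>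

definition extends_product ::
  "('a \<rightharpoonup> complex) \<Rightarrow> ('a \<Rightarrow> complex) \<Rightarrow> ('a \<Rightarrow> complex) \<Rightarrow> bool" where
  "extends_product \<phi> h g \<longleftrightarrow> (\<forall>x\<in>dom \<phi>. g x = the (\<phi> x) * h x)"

definition mult_dom :: "'a fun_space \<Rightarrow> ('a \<rightharpoonup> complex) \<Rightarrow> ('a \<Rightarrow> complex) set" where
  "mult_dom H \<phi> = {h \<in> elems H. \<exists>g\<in>elems H. extends_product \<phi> h g}"

text \<open>The quotient of \<open>H\<close> by a subspace \<open>E\<close> is spanned by finitely many classes.\<close>

definition finite_codim :: "'a fun_space \<Rightarrow> ('a \<Rightarrow> complex) set \<Rightarrow> bool" where
  "finite_codim H E \<longleftrightarrow>
     (\<exists>B. finite B \<and> B \<subseteq> elems H \<and> (\<forall>h\<in>elems H. \<exists>b\<in>cfun.span B. h - b \<in> E))"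

definition pseudomultiplier :: "'a fun_space \<Rightarrow> ('a \<rightharpoonup> complex) \<Rightarrow> bool" where
  "pseudomultiplier H \<phi> \<longleftrightarrow>
     set_of_uniqueness H (dom \<phi>) \<and>
     closedin (ftopology H) (mult_dom H \<phi>) \<and>
     finite_codim H (mult_dom H \<phi>)"

definition pseudopole :: "'a fun_space \<Rightarrow> ('a \<rightharpoonup> complex) \<Rightarrow> 'a \<Rightarrow> bool" where
  "pseudopole H \<phi> \<alpha> \<longleftrightarrow>
     (\<exists>g\<in>elems H. \<exists>h\<in>mult_dom H \<phi>. h \<alpha> = 0 \<and> extends_product \<phi> h g \<and> g \<alpha> \<noteq> 0)"

text \<open>
  The set with one point \<open>p\<close> adjoined is \<open>'a option\<close>, with \<open>p = None\<close>; restriction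
  to the original set is composition with \<open>Some\<close>.
\<close>

definition adjoin_value ::
  "'a fun_space \<Rightarrow> ('a \<Rightarrow> complex) \<Rightarrow> ('a \<Rightarrow> complex) \<Rightarrow> 'a option \<Rightarrow> complex" where
  "adjoin_value H v f = (\<lambda>x. case x of None \<Rightarrow> ip H f v | Some y \<Rightarrow> f y)"

definition adjoin_space :: "'a fun_space \<Rightarrow> ('a \<Rightarrow> complex) \<Rightarrow> 'a option fun_space" where
  "adjoin_space H v =
     \<lparr>elems = adjoin_value H v ` elems H,
      ip = (\<lambda>F G. ip H (F \<circ> Some) (G \<circ> Some))\<rparr>"

definition sees_with_value ::
  "'a fun_space \<Rightarrow> ('a \<rightharpoonup> complex) \<Rightarrow> ('a \<Rightarrow> complex) \<Rightarrow> complex \<Rightarrow> bool" where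
  "sees_with_value H \<phi> v c \<longleftrightarrow>
     v \<in> elems H \<and>
     (\<exists>\<psi>. pseudomultiplier (adjoin_space H v) \<psi> \<and>
          \<phi> \<subseteq>\<^sub>m \<psi> \<circ> Some \<and>
          mult_dom H \<phi> = (\<lambda>F. F \<circ> Some) ` mult_dom (adjoin_space H v) \<psi> \<and>
          \<psi> None = Some c)"

definition sees :: "'a fun_space \<Rightarrow> ('a \<rightharpoonup> complex) \<Rightarrow> ('a \<Rightarrow> complex) \<Rightarrow> bool" where
  "sees H \<phi> v \<longleftrightarrow> (\<exists>c. sees_with_value H \<phi> v c)"

definition ambiguous :: "'a fun_space \<Rightarrow> ('a \<rightharpoonup> complex) \<Rightarrow> ('a \<Rightarrow> complex) set" where
  "ambiguous H \<phi> = {v \<in> elems H. \<forall>c. sees_with_value H \<phi> v c}"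

definition orth_compl :: "'a fun_space \<Rightarrow> ('a \<Rightarrow> complex) set \<Rightarrow> ('a \<Rightarrow> complex) set" where
  "orth_compl H A = {f \<in> elems H. \<forall>a\<in>A. ip H f a = 0}"

text \<open>Orthogonal projection of \<open>f\<close> onto a closed subspace \<open>M\<close>.\<close>

definition orth_proj ::
  "'a fun_space \<Rightarrow> ('a \<Rightarrow> complex) set \<Rightarrow> ('a \<Rightarrow> complex) \<Rightarrow> 'a \<Rightarrow> complex" where
  "orth_proj H M f = (THE g. g \<in> M \<and> f - g \<in> orth_compl H M)"

definition definable :: "'a fun_space \<Rightarrow> ('a \<rightharpoonup> complex) \<Rightarrow> ('a \<Rightarrow> complex) set" where
  "definable H \<phi> = {d. d \<noteq> 0 \<and> sees H \<phi> d \<and> d \<in> orth_compl H (ambiguous H \<phi>)}"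

definition value_at :: "'a fun_space \<Rightarrow> ('a \<rightharpoonup> complex) \<Rightarrow> ('a \<Rightarrow> complex) \<Rightarrow> complex" where
  "value_at H \<phi> d = (THE c. sees_with_value H \<phi> d c)"

definition polar_vector :: "'a fun_space \<Rightarrow> ('a \<rightharpoonup> complex) \<Rightarrow> ('a \<Rightarrow> complex) \<Rightarrow> bool" where
  "polar_vector H \<phi> q \<longleftrightarrow>
     q \<in> elems H \<and> q \<noteq> 0 \<and>
     (\<exists>d :: nat \<Rightarrow> 'a \<Rightarrow> complex.
        (\<forall>n. d n \<in> definable H \<phi>) \<and>
        limitin (ftopology H) d q sequentially \<and>
        filterlim (\<lambda>n. value_at H \<phi> (d n)) at_infinity sequentially)"

end

theory Submission imports Defs begin

text \<open>
  Write \<open>E\<close> for the domain of multiplication by \<open>\<phi>\<close> and \<open>M h\<close> for the element of \<open>H\<close> that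
  agrees with \<open>\<phi> h\<close> on \<open>dom \<phi>\<close>, for \<open>h \<in> E\<close>. Unwinding the space with one point adjoined
  shows that \<open>\<phi>\<close> sees \<open>v\<close> with value \<open>c\<close> exactly when \<open>\<langle>M h, v\<rangle> = c \<langle>h, v\<rangle>\<close> for all \<open>h \<in> E\<close>
  (\<open>sees_with_value_iff\<close>), that is, when the adjoint of \<open>M\<close> sends \<open>v\<close> to \<open>c\<close> times the
  projection of \<open>v\<close> onto \<open>E\<close>. Taking \<open>c = 0\<close> and \<open>c = 1\<close>, the
  ambiguous vectors are those orthogonal both to \<open>E\<close> and to the range of \<open>M\<close>
  (\<open>ambiguous_iff\<close>). So, if \<open>P\<close> is the projection onto the orthogonal complement of the
  ambiguous vectors, replacing \<open>v\<close> by \<open>P v\<close> changes none of the numbers \<open>\<langle>h, v\<rangle>\<close> and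
  \<open>\<langle>M h, v\<rangle>\<close>.

  For \<open>x \<in> dom \<phi>\<close> the identity \<open>M h x = \<phi> x * h x\<close> says that \<open>\<phi>\<close> sees \<open>k\<^sub>x\<close> with value
  \<open>\<phi> x\<close>, hence also \<open>P k\<^sub>x\<close>; if the latter is nonzero it is definable, with that value
  (\<open>definable_proj_kernel\<close>). Now let \<open>h\<close> and \<open>g = M h\<close> witness the pseudopole, so that
  \<open>h \<alpha> = 0\<close> and \<open>g \<alpha> \<noteq> 0\<close>, and let \<open>y\<^sub>n\<close> be points of \<open>dom \<phi>\<close> with kernels converging to
  \<open>k\<^sub>\<alpha>\<close>. Then \<open>P k\<close> at \<open>y\<^sub>n\<close> converges to \<open>P k\<^sub>\<alpha>\<close>, and \<open>\<langle>g, P k\<^sub>\<alpha>\<rangle> = g \<alpha> \<noteq> 0\<close> shows that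
  the limit is nonzero. Finally \<open>\<phi> y\<^sub>n = g y\<^sub>n / h y\<^sub>n\<close>, where the numerators tend to \<open>g \<alpha>\<close>
  and the denominators to \<open>0\<close>, so the values tend to infinity.

  The kernels and the projection are defined by definite descriptions, so their existence has
  to come from completeness: the projection theorem for closed subspaces
  (\<open>ex_orth_decomposition\<close>) and the Riesz representation of point evaluations
  (\<open>ex_repr_kernel\<close>).
\<close>

section \<open>Inner product geometry of a Hilbert function space\<close>

locale hilbert_functions =
  fixes H :: "'a fun_space"
  assumes hilbert: "hilbert_function_space H"
begin

lemma subspace_elems: "cfun.subspace (elems H)"
  and ip_add_left: "\<lbrakk>f \<in> elems H; g \<in> elems H; h \<in> elems H\<rbrakk> \<Longrightarrow> ip H (f + g) h = ip H f h + ip H g h"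
  and ip_scale_left: "\<lbrakk>f \<in> elems H; g \<in> elems H\<rbrakk> \<Longrightarrow> ip H (fscale c f) g = c * ip H f g"
  and ip_commute: "\<lbrakk>f \<in> elems H; g \<in> elems H\<rbrakk> \<Longrightarrow> ip H g f = cnj (ip H f g)"
  and ip_pos: "\<lbrakk>f \<in> elems H; f \<noteq> 0\<rbrakk> \<Longrightarrow> 0 < Re (ip H f f)"
  and mcomplete_elems: "Metric_space.mcomplete (elems H) (fdist H)"
  and continuous_map_eval: "continuous_map (ftopology H) euclidean (\<lambda>f. f x)"
  using hilbert unfolding hilbert_function_space_def by blast+

lemmas elems_closed [simp] =
  cfun.subspace_0[OF subspace_elems] cfun.subspace_add[OF subspace_elems]
  cfun.subspace_diff[OF subspace_elems] cfun.subspace_scale[OF subspace_elems]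

lemma ip_add_right:
  "\<lbrakk>f \<in> elems H; g \<in> elems H; h \<in> elems H\<rbrakk> \<Longrightarrow> ip H f (g + h) = ip H f g + ip H f h"
  using ip_commute[of "g + h" f] ip_commute[of g f] ip_commute[of h f] by (simp add: ip_add_left)

lemma ip_scale_right:
  "\<lbrakk>f \<in> elems H; g \<in> elems H\<rbrakk> \<Longrightarrow> ip H f (fscale c g) = cnj c * ip H f g"
  using ip_commute[of "fscale c g" f] ip_commute[of g f] by (simp add: ip_scale_left)

lemma ip_diff_left:
  assumes "f \<in> elems H" "g \<in> elems H" "h \<in> elems H"
  shows "ip H (f - g) h = ip H f h - ip H g h"
  using ip_add_left[of "f - g" g h] assms by simp

lemma ip_diff_right:
  assumes "f \<in> elems H" "g \<in> elems H" "h \<in> elems H"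
  shows "ip H f (g - h) = ip H f g - ip H f h"
  using ip_add_right[of f "g - h" h] assms by simp

lemma ip_zero [simp]:
  assumes "f \<in> elems H"
  shows "ip H f 0 = 0" "ip H 0 f = 0"
  using ip_diff_right[of f 0 0] ip_diff_left[of 0 0 f] assms by simp_all

lemma fnorm_square: "f \<in> elems H \<Longrightarrow> (fnorm H f)\<^sup>2 = Re (ip H f f)"
  using ip_pos[of f] by (cases "f = 0") (auto simp: fnorm_def)

lemma ip_self:
  assumes "f \<in> elems H"
  shows "ip H f f = complex_of_real ((fnorm H f)\<^sup>2)"
proof -
  have "Im (ip H f f) = 0"
    using ip_commute[OF assms assms] by (metis cnj.simps(2) neg_equal_zero)
  then show ?thesis using assms by (simp add: complex_eq_iff fnorm_square)
qed

lemma fnorm_nonneg: "f \<in> elems H \<Longrightarrow> 0 \<le> fnorm H f"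
  using ip_pos[of f] by (cases "f = 0") (auto simp: fnorm_def)

lemma fnorm_eq_0_iff: "f \<in> elems H \<Longrightarrow> fnorm H f = 0 \<longleftrightarrow> f = 0"
  using ip_pos[of f] by (cases "f = 0") (auto simp: fnorm_def)

lemma fnorm_add_square:
  assumes "f \<in> elems H" "g \<in> elems H"
  shows "(fnorm H (f + g))\<^sup>2 = (fnorm H f)\<^sup>2 + 2 * Re (ip H f g) + (fnorm H g)\<^sup>2"
  using assms ip_commute[of f g] by (simp add: fnorm_square ip_add_left ip_add_right)

lemma parallelogram_law:
  assumes "f \<in> elems H" "g \<in> elems H"
  shows "(fnorm H (f + g))\<^sup>2 + (fnorm H (f - g))\<^sup>2 = 2 * (fnorm H f)\<^sup>2 + 2 * (fnorm H g)\<^sup>2"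
  using assms by (simp add: fnorm_square ip_add_left ip_add_right ip_diff_left ip_diff_right)

lemma fnorm_scale: "f \<in> elems H \<Longrightarrow> fnorm H (fscale c f) = norm c * fnorm H f"
proof (rule power2_eq_imp_eq)
  assume f: "f \<in> elems H"
  have "ip H (fscale c f) (fscale c f) = c * cnj c * complex_of_real ((fnorm H f)\<^sup>2)"
    using f by (simp add: ip_self[symmetric] ip_scale_left ip_scale_right del: of_real_power)
  also have "\<dots> = complex_of_real ((norm c * fnorm H f)\<^sup>2)"
    by (simp add: power_mult_distrib complex_norm_square[symmetric])
  finally show "(fnorm H (fscale c f))\<^sup>2 = (norm c * fnorm H f)\<^sup>2"
    using f by (simp only: fnorm_square elems_closed Re_complex_of_real)
qed (simp_all add: fnorm_nonneg)

lemma fnorm_minus_commute: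
  assumes "f \<in> elems H" "g \<in> elems H"
  shows "fnorm H (f - g) = fnorm H (g - f)"
  using fnorm_scale[of "f - g" "-1"] assms by simp

text \<open>
  Pythagoras for the component of \<open>f\<close> along \<open>g\<close>. Nonnegativity of the left side is the
  Cauchy--Schwarz inequality; minimality of \<open>fnorm H f\<close> on the line through \<open>f\<close> in direction
  \<open>g\<close> forces \<open>f\<close> to be orthogonal to \<open>g\<close>, which is how nearest points yield orthogonal
  projections.
\<close>

lemma fnorm_minus_component_square:
  assumes "f \<in> elems H" "g \<in> elems H" "g \<noteq> 0"
  shows "(fnorm H (f - fscale (ip H f g / ip H g g) g))\<^sup>2
       = (fnorm H f)\<^sup>2 - (norm (ip H f g))\<^sup>2 / (fnorm H g)\<^sup>2"
proof -
  let ?c = "ip H f g / ip H g g"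
  let ?w = "f - fscale ?c g"
  have nz: "ip H g g \<noteq> 0" using ip_pos[of g] assms by auto
  have orth: "ip H ?w g = 0"
    using assms nz by (simp add: ip_diff_left ip_scale_left)
  have "ip H ?w (fscale ?c g) = 0"
    using orth assms by (simp add: ip_scale_right)
  moreover have "f = ?w + fscale ?c g" by simp
  ultimately have "(fnorm H f)\<^sup>2 = (fnorm H ?w)\<^sup>2 + (fnorm H (fscale ?c g))\<^sup>2"
    using fnorm_add_square[of ?w "fscale ?c g"] assms by simp
  moreover have "(fnorm H (fscale ?c g))\<^sup>2 = (norm (ip H f g))\<^sup>2 / (fnorm H g)\<^sup>2"
    using assms nz fnorm_eq_0_iff[of g]
    by (simp add: fnorm_scale ip_self norm_divide norm_power power2_eq_square norm_mult)
  ultimately show ?thesis by simp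
qed

lemma Cauchy_Schwarz:
  assumes "f \<in> elems H" "g \<in> elems H"
  shows "norm (ip H f g) \<le> fnorm H f * fnorm H g"
proof (cases "g = 0")
  case False
  have "(norm (ip H f g))\<^sup>2 / (fnorm H g)\<^sup>2 \<le> (fnorm H f)\<^sup>2"
    using fnorm_minus_component_square[OF assms False]
    by (metis diff_ge_0_iff_ge zero_le_power2)
  then have "(norm (ip H f g))\<^sup>2 \<le> (fnorm H f * fnorm H g)\<^sup>2"
    using False assms fnorm_eq_0_iff[of g] by (simp add: field_simps power_mult_distrib)
  then show ?thesis
    using power2_le_imp_le assms fnorm_nonneg by (metis mult_nonneg_nonneg)
qed (use assms fnorm_nonneg in \<open>simp add: fnorm_eq_0_iff\<close>)

lemma fnorm_triangle:
  assumes "f \<in> elems H" "g \<in> elems H"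
  shows "fnorm H (f + g) \<le> fnorm H f + fnorm H g"
proof (rule power2_le_imp_le)
  have "Re (ip H f g) \<le> fnorm H f * fnorm H g"
    using Cauchy_Schwarz[OF assms] complex_Re_le_cmod order_trans by blast
  then show "(fnorm H (f + g))\<^sup>2 \<le> (fnorm H f + fnorm H g)\<^sup>2"
    using assms by (simp add: fnorm_add_square power2_sum)
qed (use assms fnorm_nonneg in simp)

text \<open>
  The prefix keeps apart the constant \<open>fdist\<close> on function spaces and the one that
  \<open>Metric_space\<close> introduces for bounded functions.
\<close>

sublocale metric: Metric_space "elems H" "fdist H"
proof
  fix f g h
  show "0 \<le> fdist H f g" by (simp add: fdist_def fnorm_nonneg)
  show "fdist H f g = fdist H g f" by (simp add: fdist_def fnorm_minus_commute)
  show "fdist H f g = 0 \<longleftrightarrow> f = g" if "f \<in> elems H" "g \<in> elems H"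
    using that by (simp add: fdist_def fnorm_eq_0_iff)
  show "fdist H f h \<le> fdist H f g + fdist H g h"
    if "f \<in> elems H" "g \<in> elems H" "h \<in> elems H"
    using that fnorm_triangle[of "f - g" "g - h"] by (simp add: fdist_def)
qed

lemma fdist_eq: "\<lbrakk>f \<in> elems H; g \<in> elems H\<rbrakk> \<Longrightarrow> fdist H f g = fnorm H (f - g)"
  by (simp add: fdist_def)

section \<open>Orthogonal projection\<close>

lemma subspace_orth_compl: "A \<subseteq> elems H \<Longrightarrow> cfun.subspace (orth_compl H A)"
  by (auto simp: cfun.subspace_def orth_compl_def ip_add_left ip_scale_left subset_iff)

lemma closedin_orth_compl:
  assumes "A \<subseteq> elems H"
  shows "closedin (ftopology H) (orth_compl H A)"
proof -
  have "l \<in> orth_compl H A" if \<sigma>: "range \<sigma> \<subseteq> orth_compl H A" and lim: "limitin (ftopology H) \<sigma> l sequentially"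
    for \<sigma> l
  proof -
    have l: "l \<in> elems H" using lim metric.limitin_mspace by blast
    have \<sigma>H: "\<sigma> n \<in> elems H" for n using \<sigma> by (auto simp: orth_compl_def)
    have "ip H l a = 0" if "a \<in> A" for a
    proof -
      have a: "a \<in> elems H" using that assms by blast
      have "norm (ip H l a) \<le> fdist H (\<sigma> n) l * fnorm H a" for n
      proof -
        have "ip H l a = ip H (l - \<sigma> n) a"
          using \<sigma> that a l \<sigma>H by (auto simp: ip_diff_left orth_compl_def)
        then show ?thesis
          using Cauchy_Schwarz[of "l - \<sigma> n" a] a l \<sigma>H by (simp add: fdist_eq fnorm_minus_commute)
      qed
      moreover have "(\<lambda>n. fdist H (\<sigma> n) l * fnorm H a) \<longlonglongrightarrow> 0"
        using lim by (intro tendsto_mult_left_zero) (simp add: metric.limitin_metric_dist_null)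
      ultimately have "norm (ip H l a) \<le> 0"
        by (intro LIMSEQ_le_const) blast+
      then show ?thesis by simp
    qed
    with l show ?thesis by (simp add: orth_compl_def)
  qed
  then show ?thesis
    unfolding metric.metric_closedin_iff_sequentially_closed orth_compl_def by blast
qed

text \<open>
  A minimising sequence is Cauchy: the midpoint of two of its members lies in \<open>M\<close>, hence is no
  closer to \<open>f\<close> than the infimum, and the parallelogram law then bounds their distance.
  The limit exists by completeness and lies in \<open>M\<close> because \<open>M\<close> is closed.
\<close>

lemma ex_nearest_point:
  assumes M: "cfun.subspace M" "closedin (ftopology H) M" and f: "f \<in> elems H"
  obtains m where "m \<in> M" "\<And>w. w \<in> M \<Longrightarrow> fnorm H (f - m) \<le> fnorm H (f - w)"
proof -
  have MH: "w \<in> elems H" if "w \<in> M" for w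
    using that M(2) closedin_subset by fastforce
  define S where "S = (\<lambda>w. (fnorm H (f - w))\<^sup>2) ` M"
  define \<delta> where "\<delta> = Inf S"
  have ne: "S \<noteq> {}" using cfun.subspace_0[OF M(1)] by (auto simp: S_def)
  have bdd: "bdd_below S" by (rule bdd_belowI[of _ 0]) (auto simp: S_def)
  have lower: "\<delta> \<le> (fnorm H (f - w))\<^sup>2" if "w \<in> M" for w
    unfolding \<delta>_def using bdd that by (intro cInf_lower) (auto simp: S_def)
  have "\<exists>w\<in>M. (fnorm H (f - w))\<^sup>2 < \<delta> + e" if "e > 0" for e
    using cInf_lessD[OF ne, of "\<delta> + e"] that by (auto simp: \<delta>_def S_def)
  then have "\<exists>w\<in>M. (fnorm H (f - w))\<^sup>2 < \<delta> + inverse (real (Suc n))" for n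
    by simp
  then obtain \<sigma> where \<sigma>: "\<And>n. \<sigma> n \<in> M"
      "\<And>n. (fnorm H (f - \<sigma> n))\<^sup>2 < \<delta> + inverse (real (Suc n))"
    by metis
  have \<sigma>H: "\<sigma> n \<in> elems H" for n using \<sigma> MH by blast
  have gap: "(fnorm H (\<sigma> i - \<sigma> j))\<^sup>2 \<le> 2 * inverse (real (Suc i)) + 2 * inverse (real (Suc j))" for i j
  proof -
    let ?u = "f - \<sigma> i" and ?v = "f - \<sigma> j"
    let ?mid = "fscale (1/2) (\<sigma> i + \<sigma> j)"
    have mid: "?mid \<in> M" using \<sigma> M(1) by (simp add: cfun.subspace_scale cfun.subspace_add)
    have e1: "?u + ?v = fscale 2 (f - ?mid)"
      by (simp add: fscale_def fun_eq_iff right_diff_distrib add_divide_distrib)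
    have e2: "?u - ?v = \<sigma> j - \<sigma> i" by simp
    have "(fnorm H (?u + ?v))\<^sup>2 + (fnorm H (\<sigma> i - \<sigma> j))\<^sup>2 = 2 * (fnorm H ?u)\<^sup>2 + 2 * (fnorm H ?v)\<^sup>2"
      using parallelogram_law[of ?u ?v] f \<sigma>H
      unfolding e2 fnorm_minus_commute[OF \<sigma>H[of j] \<sigma>H[of i]] by simp
    moreover have "(fnorm H (?u + ?v))\<^sup>2 \<ge> 4 * \<delta>"
      unfolding e1 using lower[OF mid] f MH[OF mid] by (simp add: fnorm_scale power_mult_distrib)
    ultimately show ?thesis using \<sigma>(2)[of i] \<sigma>(2)[of j] by linarith
  qed
  have "metric.MCauchy \<sigma>"
    unfolding metric.MCauchy_def
  proof (intro conjI allI impI)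
    show "range \<sigma> \<subseteq> elems H" using \<sigma>H by blast
    fix e :: real assume e: "0 < e"
    then obtain N where N: "inverse (real (Suc N)) < e\<^sup>2 / 4"
      using reals_Archimedean[of "e\<^sup>2 / 4"] by auto
    have "fdist H (\<sigma> i) (\<sigma> j) < e" if "N \<le> i" "N \<le> j" for i j
    proof -
      have "inverse (real (Suc i)) \<le> inverse (real (Suc N))"
        "inverse (real (Suc j)) \<le> inverse (real (Suc N))"
        using that by (simp_all add: le_imp_inverse_le)
      then have "(fnorm H (\<sigma> i - \<sigma> j))\<^sup>2 < e\<^sup>2" using gap[of i j] N by linarith
      then show ?thesis using e \<sigma>H by (simp add: fdist_eq power2_less_imp_less)
    qed
    then show "\<exists>N. \<forall>n n'. N \<le> n \<longrightarrow> N \<le> n' \<longrightarrow> fdist H (\<sigma> n) (\<sigma> n') < e" by blast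
  qed
  then obtain m where m: "limitin (ftopology H) \<sigma> m sequentially"
    using mcomplete_elems unfolding metric.mcomplete_def by blast
  have mM: "m \<in> M"
    using limitin_closedin[OF m M(2)] \<sigma> by simp
  have mH: "m \<in> elems H" using mM MH by blast
  have "fnorm H (f - m) \<le> fnorm H (f - w)" if w: "w \<in> M" for w
  proof -
    have nonneg: "0 \<le> fnorm H (f - w)" using w MH f by (simp add: fnorm_nonneg)
    have "fnorm H (f - m) \<le> sqrt ((fnorm H (f - w))\<^sup>2 + inverse (real (Suc n))) + fdist H (\<sigma> n) m" for n
    proof -
      have "fnorm H (f - m) \<le> fnorm H (f - \<sigma> n) + fdist H (\<sigma> n) m"
        using fnorm_triangle[of "f - \<sigma> n" "\<sigma> n - m"] f \<sigma>H mH by (simp add: fdist_eq)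
      moreover have "fnorm H (f - \<sigma> n) \<le> sqrt ((fnorm H (f - w))\<^sup>2 + inverse (real (Suc n)))"
        using \<sigma>(2)[of n] lower[OF w] by (intro real_le_rsqrt) linarith
      ultimately show ?thesis by linarith
    qed
    moreover have "(\<lambda>n. sqrt ((fnorm H (f - w))\<^sup>2 + inverse (real (Suc n))) + fdist H (\<sigma> n) m)
        \<longlonglongrightarrow> sqrt ((fnorm H (f - w))\<^sup>2 + 0) + 0"
      using m by (intro tendsto_intros LIMSEQ_inverse_real_of_nat) (simp add: metric.limitin_metric_dist_null)
    ultimately have "fnorm H (f - m) \<le> sqrt ((fnorm H (f - w))\<^sup>2 + 0) + 0"
      by (intro LIMSEQ_le_const) blast+
    then show ?thesis using nonneg by simp
  qed
  with mM that show ?thesis by blast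
qed

lemma ex_orth_decomposition:
  assumes M: "cfun.subspace M" "closedin (ftopology H) M" and f: "f \<in> elems H"
  obtains m where "m \<in> M" "f - m \<in> orth_compl H M"
proof -
  have MH: "w \<in> elems H" if "w \<in> M" for w
    using that M(2) closedin_subset by fastforce
  obtain m where m: "m \<in> M" and best: "\<And>w. w \<in> M \<Longrightarrow> fnorm H (f - m) \<le> fnorm H (f - w)"
    using ex_nearest_point[OF assms] by blast
  have mH: "m \<in> elems H" using m MH by blast
  have "ip H (f - m) w = 0" if w: "w \<in> M" for w
  proof (cases "w = 0")
    case False
    let ?c = "ip H (f - m) w / ip H w w"
    have "m + fscale ?c w \<in> M" using m w M(1) by (simp add: cfun.subspace_add cfun.subspace_scale)
    then have "fnorm H (f - m) \<le> fnorm H (f - m - fscale ?c w)"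
      using best by (metis diff_diff_add)
    then have "(fnorm H (f - m))\<^sup>2 \<le> (fnorm H (f - m - fscale ?c w))\<^sup>2"
      using f mH by (intro power_mono) (simp_all add: fnorm_nonneg)
    then have "(norm (ip H (f - m) w))\<^sup>2 / (fnorm H w)\<^sup>2 \<le> 0"
      using fnorm_minus_component_square[of "f - m" w] False f mH MH[OF w] by simp
    then show ?thesis
      using False fnorm_eq_0_iff[OF MH[OF w]] by (simp add: divide_le_0_iff)
  qed (use f mH in simp)
  with f mH have "f - m \<in> orth_compl H M" by (simp add: orth_compl_def)
  with m that show ?thesis by blast
qed

text \<open>
  The decomposition is unique because the difference of two candidates lies in \<open>M\<close> and is
  orthogonal to \<open>M\<close>; so the definite description defining \<open>orth_proj\<close> has a referent.
\<close>

lemma orth_proj_mem: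
  assumes M: "cfun.subspace M" "closedin (ftopology H) M" and f: "f \<in> elems H"
  shows "orth_proj H M f \<in> M \<and> f - orth_proj H M f \<in> orth_compl H M"
proof -
  have MH: "w \<in> elems H" if "w \<in> M" for w
    using that M(2) closedin_subset by fastforce
  obtain m where m: "m \<in> M" "f - m \<in> orth_compl H M"
    using ex_orth_decomposition[OF assms] by blast
  moreover have "n = m" if n: "n \<in> M" "f - n \<in> orth_compl H M" for n
  proof -
    have d: "m - n \<in> M" using m n M(1) by (simp add: cfun.subspace_diff)
    have "ip H (m - n) (m - n) = ip H (f - n) (m - n) - ip H (f - m) (m - n)"
      using m n d f MH by (simp add: ip_diff_left)
    also have "\<dots> = 0" using m n d by (simp add: orth_compl_def)
    finally show "n = m" using ip_pos[of "m - n"] MH[OF d] by fastforce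
  qed
  ultimately have "\<exists>!g. g \<in> M \<and> f - g \<in> orth_compl H M" by blast
  from theI'[OF this] show ?thesis unfolding orth_proj_def .
qed

lemma ip_orth_proj:
  assumes "cfun.subspace M" "closedin (ftopology H) M" "f \<in> elems H" "g \<in> M"
  shows "ip H g (orth_proj H M f) = ip H g f"
proof -
  let ?P = "orth_proj H M f"
  have g: "g \<in> elems H" and P: "?P \<in> elems H"
    using assms(2,4) orth_proj_mem[OF assms(1-3)] closedin_subset by fastforce+
  have "ip H (f - ?P) g = 0"
    using orth_proj_mem[OF assms(1-3)] assms(4) by (simp add: orth_compl_def)
  then have "ip H g (f - ?P) = 0" using ip_commute[of "f - ?P" g] g P assms(3) by simp
  then show ?thesis using g P assms(3) by (simp add: ip_diff_right)
qed

lemma orth_proj_contraction: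
  assumes M: "cfun.subspace M" "closedin (ftopology H) M" and fg: "f \<in> elems H" "g \<in> elems H"
  shows "fdist H (orth_proj H M f) (orth_proj H M g) \<le> fdist H f g"
proof -
  let ?p = "orth_proj H M f - orth_proj H M g"
  have PH: "orth_proj H M f \<in> elems H" "orth_proj H M g \<in> elems H"
    using orth_proj_mem[OF M] fg M(2) closedin_subset by fastforce+
  have p: "?p \<in> M" using orth_proj_mem[OF M] fg M(1) by (simp add: cfun.subspace_diff)
  have "ip H ?p ?p = ip H ?p (f - g)"
    using ip_orth_proj[OF M fg(1) p] ip_orth_proj[OF M fg(2) p] PH fg by (simp add: ip_diff_right)
  then have "ip H ?p (f - g) = complex_of_real ((fnorm H ?p)\<^sup>2)"
    using ip_self[of ?p] PH by simp
  then have "(fnorm H ?p)\<^sup>2 = norm (ip H ?p (f - g))"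
    by (simp only: norm_of_real abs_power2)
  also have "\<dots> \<le> fnorm H ?p * fnorm H (f - g)"
    using PH fg by (intro Cauchy_Schwarz) simp_all
  finally have "fnorm H ?p * fnorm H ?p \<le> fnorm H ?p * fnorm H (f - g)"
    by (simp add: power2_eq_square)
  then have "fnorm H ?p \<le> fnorm H (f - g)"
    using PH fg fnorm_nonneg[of ?p] fnorm_nonneg[of "f - g"]
    by (cases "fnorm H ?p = 0") auto
  then show ?thesis using PH fg by (simp add: fdist_eq)
qed

section \<open>Reproducing kernels\<close>

text \<open>
  The Riesz argument: a vector \<open>r\<close> orthogonal to the closed hyperplane of functions vanishing
  at \<open>x\<close>, suitably scaled, represents evaluation at \<open>x\<close>.
\<close>

lemma ex_repr_kernel: "\<exists>k\<in>elems H. \<forall>f\<in>elems H. f x = ip H f k"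
proof (cases "\<forall>f\<in>elems H. f x = 0")
  case True
  then show ?thesis by (intro bexI[of _ 0]) auto
next
  case False
  then obtain f\<^sub>0 where f0: "f\<^sub>0 \<in> elems H" "f\<^sub>0 x \<noteq> 0" by blast
  define K where "K = {f \<in> elems H. f x = 0}"
  have K: "cfun.subspace K"
    by (auto simp: K_def cfun.subspace_def) (simp add: fscale_def)
  have "closedin (ftopology H) {f \<in> topspace (ftopology H). f x \<in> {0}}"
    using continuous_map_eval by (rule closedin_continuous_map_preimage) simp
  then have cl: "closedin (ftopology H) K" by (simp add: K_def)
  obtain m where m: "m \<in> K" "f\<^sub>0 - m \<in> orth_compl H K"
    using ex_orth_decomposition[OF K cl f0(1)] by blast
  define r where "r = f\<^sub>0 - m"
  have r: "r \<in> elems H" "r x \<noteq> 0" using m f0 by (auto simp: r_def K_def)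
  have rr: "ip H r r \<noteq> 0" using ip_pos[of r] r by (metis less_irrefl zero_complex.sel(1) zero_fun_apply)
  have "f x = ip H f (fscale (cnj (r x / ip H r r)) r)" if f: "f \<in> elems H" for f
  proof -
    have "f - fscale (f x / r x) r \<in> K" using f r by (simp add: K_def) (simp add: fscale_def)
    then have "ip H r (f - fscale (f x / r x) r) = 0" using m by (simp add: orth_compl_def r_def)
    then have "ip H (f - fscale (f x / r x) r) r = 0"
      using ip_commute[of r "f - fscale (f x / r x) r"] f r by simp
    then show ?thesis using f r rr by (simp add: ip_diff_left ip_scale_left ip_scale_right field_simps)
  qed
  with r show ?thesis by (intro bexI[of _ "fscale (cnj (r x / ip H r r)) r"]) auto
qed

lemma repr_kernel_mem [simp]: "repr_kernel H x \<in> elems H"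
  and eval_eq_ip: "f \<in> elems H \<Longrightarrow> f x = ip H f (repr_kernel H x)"
proof -
  obtain k where k: "k \<in> elems H" "\<And>f. f \<in> elems H \<Longrightarrow> f x = ip H f k"
    using ex_repr_kernel by blast
  have "k' = k" if "k' \<in> elems H" "\<forall>f\<in>elems H. f x = ip H f k'" for k'
  proof -
    have "ip H (k' - k) (k' - k) = 0"
      using that k by (metis elems_closed(3) ip_diff_right right_minus_eq)
    then show ?thesis using ip_pos[of "k' - k"] that k by fastforce
  qed
  then have "\<exists>!k. k \<in> elems H \<and> (\<forall>f\<in>elems H. f x = ip H f k)" using k by blast
  from theI'[OF this]
  show "repr_kernel H x \<in> elems H" "f \<in> elems H \<Longrightarrow> f x = ip H f (repr_kernel H x)"
    unfolding repr_kernel_def by blast+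
qed

section \<open>Adjoining a point\<close>

lemma elems_adjoin_space_iff:
  "F \<in> elems (adjoin_space H v) \<longleftrightarrow> F \<circ> Some \<in> elems H \<and> F None = ip H (F \<circ> Some) v"
proof
  assume "F \<in> elems (adjoin_space H v)"
  then show "F \<circ> Some \<in> elems H \<and> F None = ip H (F \<circ> Some) v"
    by (auto simp: adjoin_space_def adjoin_value_def comp_def)
next
  assume "F \<circ> Some \<in> elems H \<and> F None = ip H (F \<circ> Some) v"
  then show "F \<in> elems (adjoin_space H v)"
    unfolding adjoin_space_def adjoin_value_def
    by (auto intro!: image_eqI[of _ _ "F \<circ> Some"] simp: fun_eq_iff split: option.split)
qed

lemma adjoin_value_Some [simp]: "adjoin_value H v f \<circ> Some = f"
  by (auto simp: adjoin_value_def)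

lemma adjoin_value_None [simp]: "adjoin_value H v f None = ip H f v"
  by (simp add: adjoin_value_def)

lemma adjoin_value_mem: "f \<in> elems H \<Longrightarrow> adjoin_value H v f \<in> elems (adjoin_space H v)"
  by (simp add: elems_adjoin_space_iff)

lemma adjoin_value_comp_Some:
  "F \<in> elems (adjoin_space H v) \<Longrightarrow> adjoin_value H v (F \<circ> Some) = F"
  by (auto simp: elems_adjoin_space_iff adjoin_value_def fun_eq_iff split: option.split)

lemma fdist_adjoin_space:
  assumes "F \<in> elems (adjoin_space H v)" "G \<in> elems (adjoin_space H v)" "v \<in> elems H"
  shows "fdist (adjoin_space H v) F G = fdist H (F \<circ> Some) (G \<circ> Some)"
proof -
  have "(F - G) \<circ> Some = (F \<circ> Some) - (G \<circ> Some)" by auto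
  then have "fnorm (adjoin_space H v) (F - G) = fnorm H ((F \<circ> Some) - (G \<circ> Some))"
    by (simp add: fnorm_def adjoin_space_def)
  then show ?thesis
    using assms by (simp add: fdist_def elems_adjoin_space_iff)
qed

text \<open>
  Restriction to the original points is an isometric bijection, so metric properties of the
  extended space are pulled back from \<open>H\<close>.
\<close>

lemma Metric_space_adjoin_space:
  assumes v: "v \<in> elems H"
  shows "Metric_space (elems (adjoin_space H v)) (fdist (adjoin_space H v))"
proof
  let ?K = "adjoin_space H v"
  have restr: "F \<circ> Some \<in> elems H" if "F \<in> elems ?K" for F
    using that by (simp add: elems_adjoin_space_iff)
  fix F G L
  show "0 \<le> fdist ?K F G"
    using fdist_adjoin_space[OF _ _ v] by (cases "F \<in> elems ?K \<and> G \<in> elems ?K") (auto simp: fdist_def[of ?K])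
  show "fdist ?K F G = fdist ?K G F"
    using fdist_adjoin_space[OF _ _ v] metric.commute
    by (cases "F \<in> elems ?K \<and> G \<in> elems ?K") (auto simp: fdist_def[of ?K])
  show "fdist ?K F G = 0 \<longleftrightarrow> F = G" if "F \<in> elems ?K" "G \<in> elems ?K"
    using fdist_adjoin_space[OF that v] metric.zero[OF restr restr, OF that]
      adjoin_value_comp_Some[OF that(1)] adjoin_value_comp_Some[OF that(2)] by metis
  show "fdist ?K F L \<le> fdist ?K F G + fdist ?K G L"
    if "F \<in> elems ?K" "G \<in> elems ?K" "L \<in> elems ?K"
    using that metric.triangle[OF restr restr restr] by (simp add: fdist_adjoin_space v)
qed

lemma continuous_map_restrict_adjoin:
  assumes v: "v \<in> elems H"
  shows "continuous_map (ftopology (adjoin_space H v)) (ftopology H) (\<lambda>F. F \<circ> Some)"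
proof -
  interpret K: Metric_space "elems (adjoin_space H v)" "fdist (adjoin_space H v)"
    by (rule Metric_space_adjoin_space[OF v])
  show ?thesis
    unfolding K.metric_continuous_map[OF metric.Metric_space_axioms]
    using fdist_adjoin_space[OF _ _ v] by (auto simp: elems_adjoin_space_iff)
qed

text \<open>
  \<open>adjoin_value\<close> is linear only on the elements of the space, the inner product being arbitrary
  elsewhere; so membership is carried along in the induction.
\<close>

lemma adjoin_value_span:
  assumes v: "v \<in> elems H" and B: "B \<subseteq> elems H" and b: "b \<in> cfun.span B"
  shows "b \<in> elems H \<and> adjoin_value H v b \<in> cfun.span (adjoin_value H v ` B)"
  using b
proof (induction rule: cfun.span_induct_alt)
  case base
  have "adjoin_value H v 0 = 0" using v by (auto simp: adjoin_value_def fun_eq_iff split: option.split)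
  then show ?case by (simp add: cfun.span_zero flip: zero_fun_def)
next
  case (step c x y)
  have x: "x \<in> elems H" using step B by blast
  have "adjoin_value H v (fscale c x + y) = fscale c (adjoin_value H v x) + adjoin_value H v y"
    using step x v
    by (auto simp: adjoin_value_def fun_eq_iff ip_add_left ip_scale_left split: option.split)
       (simp add: fscale_def)+
  then have "fscale c x + y \<in> elems H \<and> adjoin_value H v (fscale c x + y) \<in> cfun.span (adjoin_value H v ` B)"
    using step x by (simp add: cfun.span_add cfun.span_scale cfun.span_base)
  then show ?case by (simp only: plus_fun_def)
qed

lemma finite_codim_adjoin_space:
  assumes v: "v \<in> elems H" and E: "finite_codim H E"
  shows "finite_codim (adjoin_space H v) {F \<in> elems (adjoin_space H v). F \<circ> Some \<in> E}"
proof -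
  obtain B where B: "finite B" "B \<subseteq> elems H" "\<And>h. h \<in> elems H \<Longrightarrow> \<exists>b\<in>cfun.span B. h - b \<in> E"
    using E unfolding finite_codim_def by blast
  have "\<exists>b\<in>cfun.span (adjoin_value H v ` B). F - b \<in> {F \<in> elems (adjoin_space H v). F \<circ> Some \<in> E}"
    if F: "F \<in> elems (adjoin_space H v)" for F
  proof -
    have FH: "F \<circ> Some \<in> elems H" using F by (simp add: elems_adjoin_space_iff)
    then obtain b where b: "b \<in> cfun.span B" "(F \<circ> Some) - b \<in> E" using B(3) by blast
    have bH: "b \<in> elems H" and sp: "adjoin_value H v b \<in> cfun.span (adjoin_value H v ` B)"
      using adjoin_value_span[OF v B(2) b(1)] by auto
    have *: "(F - adjoin_value H v b) \<circ> Some = (F \<circ> Some) - b"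
      by (auto simp: adjoin_value_def)
    have "F - adjoin_value H v b \<in> elems (adjoin_space H v)"
      using F FH bH v unfolding elems_adjoin_space_iff * by (simp add: ip_diff_left)
    with * b sp show ?thesis by (intro bexI[of _ "adjoin_value H v b"]) simp_all
  qed
  then show ?thesis
    unfolding finite_codim_def using B
    by (intro exI[of _ "adjoin_value H v ` B"]) (auto simp: adjoin_value_mem)
qed

section \<open>Vectors seen by a pseudomultiplier\<close>

text \<open>
  If \<open>\<psi>\<close> witnesses that \<open>v\<close> is seen, then for \<open>h\<close> in the domain of multiplication by \<open>\<phi>\<close>
  the product with \<open>\<psi>\<close> restricts to an extension of \<open>\<phi> h\<close>, which is unique as \<open>dom \<phi>\<close> is
  a set of uniqueness; the condition at the adjoined point is the displayed equation.
  Conversely, the equation lets the extension of \<open>\<phi>\<close> by the value \<open>c\<close> at the adjoined point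
  have the same domain of multiplication as \<open>\<phi>\<close>, up to the isometry, so that it inherits
  closedness and finite codimension.
\<close>

lemma sees_with_value_iff:
  assumes \<phi>: "pseudomultiplier H \<phi>" and v: "v \<in> elems H"
  shows "sees_with_value H \<phi> v c \<longleftrightarrow>
    (\<forall>h\<in>elems H. \<forall>g\<in>elems H. extends_product \<phi> h g \<longrightarrow> ip H g v = c * ip H h v)"
    (is "?L \<longleftrightarrow> ?R")
proof
  assume ?L
  then obtain \<psi> where \<psi>: "\<phi> \<subseteq>\<^sub>m \<psi> \<circ> Some" "\<psi> None = Some c"
    "mult_dom H \<phi> = (\<lambda>F. F \<circ> Some) ` mult_dom (adjoin_space H v) \<psi>"
    unfolding sees_with_value_def by blast
  show ?R
  proof (intro ballI impI)
    fix h g assume h: "h \<in> elems H" and g: "g \<in> elems H" "extends_product \<phi> h g"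
    then have "h \<in> mult_dom H \<phi>" by (auto simp: mult_dom_def)
    then obtain F G where FG: "h = F \<circ> Some" "F \<in> elems (adjoin_space H v)"
      "G \<in> elems (adjoin_space H v)" "extends_product \<psi> F G"
      unfolding \<psi>(3) by (auto simp: mult_dom_def)
    have GH: "G \<circ> Some \<in> elems H" using FG by (simp add: elems_adjoin_space_iff)
    have "(G \<circ> Some) x = g x" if "x \<in> dom \<phi>" for x
    proof -
      have "\<psi> (Some x) = \<phi> x" using that \<psi>(1) by (auto simp: map_le_def)
      then have "Some x \<in> dom \<psi>" "the (\<psi> (Some x)) = the (\<phi> x)" using that by auto
      then show ?thesis using FG g(2) that by (simp add: extends_product_def)
    qed
    then have "G \<circ> Some = g"
      using \<phi> GH g(1) unfolding pseudomultiplier_def set_of_uniqueness_def by blast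
    moreover have "G None = c * F None"
      using FG(4) \<psi>(2) unfolding extends_product_def by (metis domI option.sel)
    ultimately show "ip H g v = c * ip H h v"
      using FG by (simp add: elems_adjoin_space_iff)
  qed
next
  assume R: ?R
  let ?K = "adjoin_space H v"
  define \<psi> where "\<psi> = (\<lambda>x. case x of None \<Rightarrow> Some c | Some y \<Rightarrow> \<phi> y)"
  have dom: "Some ` dom \<phi> \<subseteq> dom \<psi>" by (auto simp: \<psi>_def)
  have \<psi>_product: "extends_product \<psi> F G \<longleftrightarrow> extends_product \<phi> (F \<circ> Some) (G \<circ> Some) \<and> G None = c * F None"
    for F G
    unfolding extends_product_def \<psi>_def dom_def by (auto split: option.splits)
  have mult: "mult_dom ?K \<psi> = {F \<in> elems ?K. F \<circ> Some \<in> mult_dom H \<phi>}"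
  proof (intro equalityI subsetI)
    fix F assume "F \<in> mult_dom ?K \<psi>"
    then show "F \<in> {F \<in> elems ?K. F \<circ> Some \<in> mult_dom H \<phi>}"
      by (auto simp: mult_dom_def \<psi>_product elems_adjoin_space_iff)
  next
    fix F assume "F \<in> {F \<in> elems ?K. F \<circ> Some \<in> mult_dom H \<phi>}"
    then obtain g where F: "F \<in> elems ?K" and g: "g \<in> elems H" "extends_product \<phi> (F \<circ> Some) g"
      by (auto simp: mult_dom_def)
    have "extends_product \<psi> F (adjoin_value H v g)"
      using F g R by (simp add: \<psi>_product elems_adjoin_space_iff)
    then show "F \<in> mult_dom ?K \<psi>"
      using F adjoin_value_mem[OF g(1)] by (auto simp: mult_dom_def)
  qed
  have "set_of_uniqueness ?K (dom \<psi>)"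
    unfolding set_of_uniqueness_def
  proof (intro ballI impI)
    fix F G assume FG: "F \<in> elems ?K" "G \<in> elems ?K" and eq: "\<forall>x\<in>dom \<psi>. F x = G x"
    have "(F \<circ> Some) x = (G \<circ> Some) x" if "x \<in> dom \<phi>" for x
    proof -
      have "Some x \<in> dom \<psi>" using dom that by blast
      then show ?thesis using eq by simp
    qed
    then have "F \<circ> Some = G \<circ> Some"
      using \<phi> FG unfolding pseudomultiplier_def set_of_uniqueness_def elems_adjoin_space_iff
      by blast
    then show "F = G" using FG adjoin_value_comp_Some by metis
  qed
  moreover have "closedin (ftopology ?K) (mult_dom ?K \<psi>)"
  proof -
    interpret K: Metric_space "elems ?K" "fdist ?K"
      by (rule Metric_space_adjoin_space[OF v])
    have "closedin K.mtopology {F \<in> topspace K.mtopology. F \<circ> Some \<in> mult_dom H \<phi>}"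
      using \<phi> unfolding pseudomultiplier_def
      by (intro closedin_continuous_map_preimage[OF continuous_map_restrict_adjoin[OF v]]) blast
    then show ?thesis by (simp add: mult)
  qed
  moreover have "finite_codim ?K (mult_dom ?K \<psi>)"
    using \<phi> finite_codim_adjoin_space[OF v] unfolding mult pseudomultiplier_def by blast
  ultimately have "pseudomultiplier ?K \<psi>" by (simp add: pseudomultiplier_def)
  moreover have "mult_dom H \<phi> = (\<lambda>F. F \<circ> Some) ` mult_dom ?K \<psi>"
  proof (intro equalityI subsetI)
    fix h assume h: "h \<in> mult_dom H \<phi>"
    then have "h \<in> elems H" by (simp add: mult_dom_def)
    with h show "h \<in> (\<lambda>F. F \<circ> Some) ` mult_dom ?K \<psi>"
      by (intro image_eqI[of _ _ "adjoin_value H v h"]) (simp_all add: mult adjoin_value_mem)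
  qed (auto simp: mult)
  moreover have "\<phi> \<subseteq>\<^sub>m \<psi> \<circ> Some" "\<psi> None = Some c" by (auto simp: \<psi>_def map_le_def)
  ultimately show ?L using v unfolding sees_with_value_def by blast
qed

lemma ambiguous_iff:
  assumes "pseudomultiplier H \<phi>"
  shows "v \<in> ambiguous H \<phi> \<longleftrightarrow> v \<in> elems H \<and>
    (\<forall>h\<in>elems H. \<forall>g\<in>elems H. extends_product \<phi> h g \<longrightarrow> ip H h v = 0 \<and> ip H g v = 0)"
    (is "_ \<longleftrightarrow> _ \<and> ?orth")
proof (cases "v \<in> elems H")
  case True
  have "(\<forall>c. sees_with_value H \<phi> v c) \<longleftrightarrow> ?orth"
  proof
    assume all: "\<forall>c. sees_with_value H \<phi> v c"
    show ?orth
    proof (intro ballI impI)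
      fix h g assume hg: "h \<in> elems H" "g \<in> elems H" "extends_product \<phi> h g"
      have "ip H g v = c * ip H h v" for c
        using all hg sees_with_value_iff[OF assms True] by blast
      from this[of 0] this[of 1] show "ip H h v = 0 \<and> ip H g v = 0" by simp
    qed
  qed (auto simp: sees_with_value_iff[OF assms True])
  with True show ?thesis by (simp add: ambiguous_def)
qed (simp add: ambiguous_def)

lemma mult_pair_in_orth_ambiguous:
  assumes "pseudomultiplier H \<phi>" "h \<in> elems H" "g \<in> elems H" "extends_product \<phi> h g"
  shows "h \<in> orth_compl H (ambiguous H \<phi>)" "g \<in> orth_compl H (ambiguous H \<phi>)"
  using assms by (auto simp: orth_compl_def ambiguous_iff)

text \<open>
  Comparing the equations for two different values shows that a vector seen with both is
  orthogonal to every multiplicand \<open>h\<close> and to its product \<open>g\<close> with \<open>\<phi>\<close>, hence ambiguous; being also orthogonal to the ambiguous vectors, it would be zero.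
\<close>

lemma value_at_eqI:
  assumes \<phi>: "pseudomultiplier H \<phi>" and d: "d \<in> definable H \<phi>" and c: "sees_with_value H \<phi> d c"
  shows "value_at H \<phi> d = c"
  unfolding value_at_def
proof (rule the_equality[where P = "sees_with_value H \<phi> d", OF c])
  fix c' assume c': "sees_with_value H \<phi> d c'"
  have dH: "d \<in> elems H" and d0: "d \<noteq> 0" and orth: "\<And>a. a \<in> ambiguous H \<phi> \<Longrightarrow> ip H d a = 0"
    using d by (auto simp: definable_def orth_compl_def)
  show "c' = c"
  proof (rule ccontr)
    assume "c' \<noteq> c"
    have "ip H h d = 0 \<and> ip H g d = 0"
      if hg: "h \<in> elems H" "g \<in> elems H" "extends_product \<phi> h g" for h g
    proof -
      have "ip H g d = c * ip H h d" "ip H g d = c' * ip H h d"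
        using c c' hg sees_with_value_iff[OF \<phi> dH] by blast+
      with \<open>c' \<noteq> c\<close> show ?thesis by auto
    qed
    then have "d \<in> ambiguous H \<phi>" using dH by (simp add: ambiguous_iff[OF \<phi>])
    then show False using orth[of d] ip_pos[OF dH d0] by simp
  qed
qed

section \<open>Projected kernels and pseudopoles\<close>

abbreviation proj_kernel :: "('a \<rightharpoonup> complex) \<Rightarrow> 'a \<Rightarrow> 'a \<Rightarrow> complex" where
  "proj_kernel \<phi> x \<equiv> orth_proj H (orth_compl H (ambiguous H \<phi>)) (repr_kernel H x)"

lemma
  assumes \<phi>: "pseudomultiplier H \<phi>"
  shows proj_kernel_mem: "proj_kernel \<phi> x \<in> orth_compl H (ambiguous H \<phi>)"
    and ip_proj_kernel: "f \<in> orth_compl H (ambiguous H \<phi>) \<Longrightarrow> ip H f (proj_kernel \<phi> x) = f x"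
    and fdist_proj_kernel:
      "fdist H (proj_kernel \<phi> x) (proj_kernel \<phi> y) \<le> fdist H (repr_kernel H x) (repr_kernel H y)"
proof -
  have "ambiguous H \<phi> \<subseteq> elems H" by (auto simp: ambiguous_def)
  note M = subspace_orth_compl[OF this] closedin_orth_compl[OF this]
  show "proj_kernel \<phi> x \<in> orth_compl H (ambiguous H \<phi>)"
    using orth_proj_mem[OF M] by simp
  show "ip H f (proj_kernel \<phi> x) = f x" if "f \<in> orth_compl H (ambiguous H \<phi>)"
    using ip_orth_proj[OF M _ that, of "repr_kernel H x"] that eval_eq_ip[of f x]
    by (simp add: orth_compl_def)
  show "fdist H (proj_kernel \<phi> x) (proj_kernel \<phi> y) \<le> fdist H (repr_kernel H x) (repr_kernel H y)"
    using orth_proj_contraction[OF M] by simp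
qed

lemma sees_proj_kernel:
  assumes \<phi>: "pseudomultiplier H \<phi>" and x: "\<phi> x = Some c"
  shows "sees_with_value H \<phi> (proj_kernel \<phi> x) c"
proof -
  have "proj_kernel \<phi> x \<in> elems H"
    using proj_kernel_mem[OF \<phi>] by (simp add: orth_compl_def)
  moreover have "ip H g (proj_kernel \<phi> x) = c * ip H h (proj_kernel \<phi> x)"
    if hg: "h \<in> elems H" "g \<in> elems H" "extends_product \<phi> h g" for h g
  proof -
    have "g x = c * h x" using hg(3) x unfolding extends_product_def by (metis domI option.sel)
    then show ?thesis
      using mult_pair_in_orth_ambiguous[OF \<phi> hg] by (simp add: ip_proj_kernel[OF \<phi>])
  qed
  ultimately show ?thesis using sees_with_value_iff[OF \<phi>] by blast
qed

text \<open>
  The function \<open>f\<close> is there to certify that the projected kernel is nonzero, since pairing it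
  with that kernel gives \<open>f x\<close>.
\<close>

lemma definable_proj_kernel:
  assumes \<phi>: "pseudomultiplier H \<phi>" and x: "\<phi> x = Some c"
    and f: "f \<in> orth_compl H (ambiguous H \<phi>)" "f x \<noteq> 0"
  shows "proj_kernel \<phi> x \<in> definable H \<phi>" "value_at H \<phi> (proj_kernel \<phi> x) = c"
proof -
  have "f \<in> elems H" using f by (simp add: orth_compl_def)
  then have "proj_kernel \<phi> x \<noteq> 0" using ip_proj_kernel[OF \<phi> f(1), of x] f(2) by auto
  then show d: "proj_kernel \<phi> x \<in> definable H \<phi>"
    using sees_proj_kernel[OF \<phi> x] proj_kernel_mem[OF \<phi>] unfolding definable_def sees_def by blast
  show "value_at H \<phi> (proj_kernel \<phi> x) = c"
    using value_at_eqI[OF \<phi> d sees_proj_kernel[OF \<phi> x]] .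
qed

lemma polar_vector_at_pseudopole:
  assumes \<phi>: "pseudomultiplier H \<phi>" and pole: "pseudopole H \<phi> \<alpha>"
    and cl: "\<alpha> \<in> kernel_closure H (dom \<phi>)"
  shows "polar_vector H \<phi> (proj_kernel \<phi> \<alpha>)"
proof -
  let ?k = "repr_kernel H"
  obtain h g where h: "h \<in> elems H" and h\<alpha>: "h \<alpha> = 0" and g: "g \<in> elems H" "extends_product \<phi> h g"
    and g\<alpha>: "g \<alpha> \<noteq> 0"
    using pole by (auto simp: pseudopole_def mult_dom_def)
  have gA: "g \<in> orth_compl H (ambiguous H \<phi>)"
    using mult_pair_in_orth_ambiguous[OF \<phi> h g] by blast
  have PH: "proj_kernel \<phi> x \<in> elems H" for x
    using proj_kernel_mem[OF \<phi>] by (simp add: orth_compl_def)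
  have "\<exists>y\<in>dom \<phi>. fdist H (?k \<alpha>) (?k y) < inverse (real (Suc n))" for n
    using cl by (simp add: kernel_closure_def)
  then obtain \<mu> where \<mu>: "\<And>n. \<mu> n \<in> dom \<phi>"
      "\<And>n. fdist H (?k \<alpha>) (?k (\<mu> n)) < inverse (real (Suc n))"
    by metis
  have lim: "(\<lambda>n. fdist H (?k (\<mu> n)) (?k \<alpha>)) \<longlonglongrightarrow> 0"
    by (rule tendsto_sandwich[OF _ _ tendsto_const LIMSEQ_inverse_real_of_nat])
       (use \<mu>(2) in \<open>auto simp: metric.commute intro!: always_eventually less_imp_le\<close>)
  have eval_lim: "(\<lambda>n. f (\<mu> n)) \<longlonglongrightarrow> f \<alpha>" if f: "f \<in> elems H" for f
  proof (rule LIM_zero_cancel, rule tendsto_norm_zero_cancel,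
      rule tendsto_sandwich[OF _ _ tendsto_const])
    show "(\<lambda>n. fnorm H f * fdist H (?k (\<mu> n)) (?k \<alpha>)) \<longlonglongrightarrow> 0"
      using tendsto_mult_left[OF lim, of "fnorm H f"] by simp
    have "norm (f (\<mu> n) - f \<alpha>) \<le> fnorm H f * fdist H (?k (\<mu> n)) (?k \<alpha>)" for n
      using Cauchy_Schwarz[of f "?k (\<mu> n) - ?k \<alpha>"] f
      by (simp add: ip_diff_right fdist_eq eval_eq_ip)
    then show "\<forall>\<^sub>F n in sequentially. norm (f (\<mu> n) - f \<alpha>) \<le> fnorm H f * fdist H (?k (\<mu> n)) (?k \<alpha>)"
      by simp
  qed simp
  have "\<forall>\<^sub>F n in sequentially. g (\<mu> n) \<noteq> 0"
    using eval_lim[OF g(1)] g\<alpha> by (rule tendsto_imp_eventually_ne)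
  then obtain N where N: "\<And>n. n \<ge> N \<Longrightarrow> g (\<mu> n) \<noteq> 0"
    by (auto simp: eventually_sequentially)
  \<comment> \<open>Definable vectors are nonzero, so the points where \<open>g\<close> may vanish are skipped.\<close>
  define y where "y n = \<mu> (n + N)" for n
  have gy: "g (y n) \<noteq> 0" for n using N by (simp add: y_def)
  have \<phi>y: "\<phi> (y n) = Some (the (\<phi> (y n)))" for n
    using \<mu>(1) by (auto simp: y_def dom_def)
  have prod: "g (y n) = the (\<phi> (y n)) * h (y n)" for n
    using g(2) \<mu>(1) by (simp add: extends_product_def y_def)
  note def = definable_proj_kernel[OF \<phi> \<phi>y gA gy]
  have "limitin (ftopology H) (\<lambda>n. proj_kernel \<phi> (y n)) (proj_kernel \<phi> \<alpha>) sequentially"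
    unfolding metric.limitin_metric_dist_null
  proof (intro conjI)
    have "(\<lambda>n. fdist H (?k (y n)) (?k \<alpha>)) \<longlonglongrightarrow> 0"
      unfolding y_def using lim by (rule LIMSEQ_ignore_initial_segment)
    then show "(\<lambda>n. fdist H (proj_kernel \<phi> (y n)) (proj_kernel \<phi> \<alpha>)) \<longlonglongrightarrow> 0"
      by (rule tendsto_sandwich[OF _ _ tendsto_const, rotated 2])
         (simp_all add: fdist_proj_kernel[OF \<phi>])
  qed (simp_all add: PH)
  moreover have "filterlim (\<lambda>n. value_at H \<phi> (proj_kernel \<phi> (y n))) at_infinity sequentially"
  proof -
    have "(\<lambda>n. g (y n)) \<longlonglongrightarrow> g \<alpha>" "(\<lambda>n. h (y n)) \<longlonglongrightarrow> 0"
      unfolding y_def using LIMSEQ_ignore_initial_segment[OF eval_lim] g(1) h h\<alpha> by metis+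
    moreover have hy: "h (y n) \<noteq> 0" for n using prod[of n] gy[of n] by auto
    ultimately have "filterlim (\<lambda>n. inverse (h (y n))) at_infinity sequentially"
      by (intro filterlim_compose[OF filterlim_inverse_at_infinity]) (simp add: filterlim_at)
    then have "filterlim (\<lambda>n. g (y n) / h (y n)) at_infinity sequentially"
      unfolding divide_inverse
      by (rule tendsto_mult_filterlim_at_infinity[OF \<open>(\<lambda>n. g (y n)) \<longlonglongrightarrow> g \<alpha>\<close> g\<alpha>])
    moreover have "value_at H \<phi> (proj_kernel \<phi> (y n)) = g (y n) / h (y n)" for n
      using def(2)[of n] prod[of n] hy[of n] by simp
    ultimately show ?thesis by simp
  qed
  moreover have "proj_kernel \<phi> \<alpha> \<noteq> 0"
    using ip_proj_kernel[OF \<phi> gA, of \<alpha>] g\<alpha> g(1) by auto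
  ultimately show ?thesis
    unfolding polar_vector_def using def(1) PH
    by (intro conjI exI[of _ "\<lambda>n. proj_kernel \<phi> (y n)"]) simp_all
qed

end

theorem proposition6p8:
  fixes H :: "'a fun_space" and \<phi> :: "'a \<rightharpoonup> complex" and \<alpha> :: 'a
  assumes "hilbert_function_space H"
    and "pseudomultiplier H \<phi>"
    and "pseudopole H \<phi> \<alpha>"
    and "\<alpha> \<in> kernel_closure H (dom \<phi>)"
  shows "polar_vector H \<phi> (orth_proj H (orth_compl H (ambiguous H \<phi>)) (repr_kernel H \<alpha>))"
proof -
  interpret hilbert_functions H by (rule hilbert_functions.intro[OF assms(1)])
  show ?thesis using polar_vector_at_pseudopole[OF assms(2-4)] .
qed

end
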